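(* Let $2\le p<\infty$. Then there exist constants $c_1=c_1(p)>0$ and $c_2=c_2(p)>0$, depending only on $p$, such that for all real numbers $0<a<b<\infty$ the following hold. (i) The best constant $d(a,b)$ satisfies $$\left(\frac{p}{p-1}\right)^p\left(1-\frac{c_1}{\ln^2\frac{b}{a}}\right)\le d(a,b)\le \left(\frac{p}{p-1}\right)^p\left(1+\frac{c_2}{\ln^2\frac{b}{a}}\right)^{-1}.$$ (ii) Let $\alpha$ be the only solution of the equation $$\tan\left(\alpha\ln\frac{b}{a}\right)+\frac{\alpha p}{p-1}=0$$ in the interval $\left(\frac{\pi}{2\ln\frac{b}{a}},\frac{\pi}{\ln\frac{b}{a}}\right)$, and for $a\le x\le b$ let $$f^\ast(x)=\frac{1}{x^{1/p}}\left(\frac{\alpha p}{p-1}\cos\left(\alpha\ln \frac{x}{a}\right)+\sin\left(\alpha\ln \frac{x}{a}\right)\right).$$ Then $f^\ast$ is almost extremal in the sense that $$\int_a^b\left(\frac{1}{x}\int_a^x f^\ast(t)\,dt\right)^p dx\ge \left(\frac{p}{p-1}\right)^p\left(1-\frac{c_1}{\ln^2\frac{b}{a}}\right)\int_a^b [f^\ast(x)]^p\,dx.$$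
   Context: For $p>1$ and $0<a<b<\infty$, $d(a,b)$ denotes the smallest constant such that the inequality $$\int_a^b\left(\frac{1}{x}\int_a^x f(t)\,dt\right)^p dx\le d(a,b)\int_a^b [f(x)]^p\,dx$$ holds for every $f\in L^p[a,b]$ with $f(x)\ge 0$. *)

theory Defs
  imports "HOL-Analysis.Analysis"
begin

definition Lp_on :: "real \<Rightarrow> real set \<Rightarrow> (real \<Rightarrow> real) set" where
  "Lp_on p S = {f. set_borel_measurable lebesgue S f \<and>
                   set_integrable lebesgue S (\<lambda>x. \<bar>f x\<bar> powr p)}"

definition hardy_avg :: "real \<Rightarrow> (real \<Rightarrow> real) \<Rightarrow> real \<Rightarrow> real" where
  "hardy_avg a f x = (1 / x) * (LINT t:{a..x}|lebesgue. f t)"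

text \<open>For \<open>p > 1\<close>, \<open>0 < a < b\<close> and nonnegative \<open>f\<close> in \<open>L^p[a,b]\<close>, the function \<open>f\<close> is
  integrable on \<open>[a,b]\<close> and \<open>hardy_avg a f\<close> is continuous there, so none of the Bochner
  integrals below takes its default value 0 for non-integrable functions.\<close>

definition hardy_bound :: "real \<Rightarrow> real \<Rightarrow> real \<Rightarrow> real \<Rightarrow> bool" where
  "hardy_bound p a b D \<longleftrightarrow>
     (\<forall>f \<in> Lp_on p {a..b}. (\<forall>x\<in>{a..b}. 0 \<le> f x) \<longrightarrow>
        (LINT x:{a..b}|lebesgue. (hardy_avg a f x) powr p)
          \<le> D * (LINT x:{a..b}|lebesgue. (f x) powr p))"

text \<open>For \<open>p > 1\<close> and \<open>0 < a < b\<close> the admissible constants form a nonempty closed set that is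
  bounded below, so the least one exists.\<close>

definition hardy_best :: "real \<Rightarrow> real \<Rightarrow> real \<Rightarrow> real" where
  "hardy_best p a b = (LEAST D. hardy_bound p a b D)"

definition is_alpha :: "real \<Rightarrow> real \<Rightarrow> real \<Rightarrow> real \<Rightarrow> bool" where
  "is_alpha p a b \<alpha> \<longleftrightarrow>
     \<alpha> \<in> {pi / (2 * ln (b / a)) <..< pi / ln (b / a)} \<and>
     tan (\<alpha> * ln (b / a)) + \<alpha> * p / (p - 1) = 0"

definition f_star :: "real \<Rightarrow> real \<Rightarrow> real \<Rightarrow> real \<Rightarrow> real" where
  "f_star p a \<alpha> x =
     1 / (x powr (1 / p)) *
       (\<alpha> * p / (p - 1) * cos (\<alpha> * ln (x / a)) + sin (\<alpha> * ln (x / a)))"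

end

theory Submission
  imports Defs
begin

text \<open>Substituting \<open>x = a e\<^sup>t\<close>, the problem lives on the interval \<open>0 \<le> t \<le> L\<close> with \<open>L = ln (b / a)\<close>.
On an infinite interval the constant \<open>(p / (p - 1)) powr p\<close> would be sharp but not attained; on a
finite one the function is confined to an interval of length \<open>L\<close>, and this costs a relative
amount of order \<open>1 / L\<^sup>2\<close>, as for a first Dirichlet eigenvalue.

Upper bound. If \<open>F\<close> is the primitive of \<open>f\<close> vanishing at \<open>a\<close>, Hardy's inequality with constant
\<open>1 / l\<close> says \<open>l * \<integral> x powr (-p) * F powr p \<le> \<integral> F' powr p\<close>. This follows from any positive solution \<open>w\<close>
of the Riccati inequality \<open>w' + (p - 1) * w powr (p / (p - 1)) + l * x powr (-p) \<le> 0\<close>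
(\<open>hardy_bound_of_riccati\<close>). Formally one integrates the derivative of \<open>w * F powr p\<close> and applies
Young's inequality. To avoid differentiating the merely absolutely continuous \<open>F\<close>, the proof
takes the positive function \<open>u\<close> with \<open>u' / u = w powr (1 / (p - 1))\<close>, for which
\<open>u' powr (p - 1) = w * u powr (p - 1)\<close>, and uses \<open>u'\<close> as the weight in a Schur test
(\<open>schur_test_hardy\<close>): Jensen's inequality for the inner integral, then Tonelli's theorem.
With \<open>w = x powr (1 - p) * g\<close> the Riccati inequality becomes
\<open>(p - 1) * (g - g powr (p / (p - 1))) - dg/dt \<ge> l\<close>. The constant \<open>g\<close> that maximizes the left side
yields the classical constant. Adding to it the decreasing function \<open>d * (L - t) / L\<^sup>2\<close> gains
\<open>d / L\<^sup>2\<close> from the derivative and loses only a quadratic term of order \<open>d\<^sup>2 / L\<^sup>2\<close>, so \<open>l\<close> can be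
increased by a multiple of \<open>1 / L\<^sup>2\<close> (\<open>hardy_bound_log_improved\<close>). The loss is quadratic for
arbitrarily short intervals as well because \<open>p \<ge> 2\<close> makes the exponent \<open>p / (p - 1)\<close> at most 2.

Lower bound. Put \<open>k = \<alpha> * p / (p - 1)\<close>. The equation for \<open>\<alpha>\<close> says that \<open>f_star\<close> vanishes at \<open>b\<close>,
and therefore
\<open>f_star p a \<alpha> x = sqrt (1 + k\<^sup>2) * x powr (-1/p) * sin (\<alpha> * ln (b / x))\<close>,
while \<open>hardy_avg a (f_star p a \<alpha>) x = p / (p - 1) * x powr (-1/p) * sin (\<alpha> * ln (x / a))\<close>.
The reflection \<open>x \<mapsto> a * b / x\<close> exchanges the two sines and preserves \<open>dx / x\<close>, so the quotient of
the two integrals is exactly \<open>(p / (p - 1)) powr p * (1 + k\<^sup>2) powr (-p / 2)\<close>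
(\<open>f_star_quotient\<close>). As \<open>\<alpha> < pi / L\<close>, Bernoulli's inequality finishes the argument.\<close>

section \<open>A weighted Schur test for the averaging operator\<close>

text \<open>Convexity of \<open>x powr p\<close>: the graph lies above its tangent at \<open>c\<close>. The inequality is divided by
\<open>c powr (p - 1)\<close> and contains no subtraction, so that it can be integrated in \<open>ennreal\<close>.\<close>

lemma powr_tangent_line:
  fixes p x c :: real
  assumes "p > 1" "x \<ge> 0" "c > 0"
  shows "p * x \<le> (p - 1) * c + x powr p * c powr (1 - p)"
proof (cases "x = 0")
  case True
  then show ?thesis using assms by simp
next
  case False
  then have x: "x > 0" using assms by simp
  have 1: "(x powr p * c powr (1 - p)) powr (1/p) * c powr (1 - 1/p) = x"
  proof -
    have "(x powr p * c powr (1 - p)) powr (1/p) * c powr (1 - 1/p)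
        = x powr (p * (1/p)) * (c powr ((1 - p) * (1/p)) * c powr (1 - 1/p))"
      using x assms by (simp add: powr_mult powr_powr)
    also have "\<dots> = x * c powr ((1 - p) * (1/p) + (1 - 1/p))"
      using x assms by (simp add: powr_add)
    also have "(1 - p) * (1/p) + (1 - 1/p) = 0"
      using assms by (simp add: field_simps)
    finally show ?thesis using assms by simp
  qed
  have "x \<le> (1/p) * (x powr p * c powr (1 - p)) + (1 - 1/p) * c"
    using Youngs_inequality_0[of "1/p" "1 - 1/p" "x powr p * c powr (1 - p)" c] x assms 1
    by simp
  then have "p * x \<le> p * ((1/p) * (x powr p * c powr (1 - p)) + (1 - 1/p) * c)"
    using assms by (intro mult_left_mono) auto
  also have "\<dots> = (p - 1) * c + x powr p * c powr (1 - p)"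
    using assms by (simp add: field_simps)
  finally show ?thesis .
qed

text \<open>This is Jensen's inequality for \<open>f / h\<close> and the measure with density \<open>h\<close>. It is proved by integrating
the tangent line inequality at the multiple of \<open>h\<close> that has the same total mass as \<open>f\<close> (up to
\<open>U\<close> being only an upper bound for the mass of \<open>h\<close>). The right-hand side may be infinite, which is
why it is a nonnegative integral.\<close>

lemma powr_integral_le_weighted:
  fixes f h :: "real \<Rightarrow> real"
  assumes p: "p > 1" and U: "U > 0"
    and f: "set_integrable M S f" "\<And>t. t \<in> S \<Longrightarrow> 0 \<le> f t"
    and h: "set_integrable M S h" "\<And>t. t \<in> S \<Longrightarrow> 0 < h t"
    and hU: "(LINT t:S|M. h t) \<le> U"
    and meas: "(\<lambda>t. ennreal (f t powr p * h t powr (1 - p)) * indicator S t) \<in> borel_measurable M"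
  shows "ennreal ((LINT t:S|M. f t) powr p)
    \<le> ennreal (U powr (p - 1)) * (\<integral>\<^sup>+t. ennreal (f t powr p * h t powr (1 - p)) * indicator S t \<partial>M)"
proof -
  define F where "F = (LINT t:S|M. f t)"
  define Y where "Y = (\<integral>\<^sup>+t. ennreal (f t powr p * h t powr (1 - p)) * indicator S t \<partial>M)"
  have F0: "F \<ge> 0"
    unfolding F_def set_lebesgue_integral_def
    by (intro integral_nonneg_AE AE_I2) (auto simp: indicator_def f)
  have nnf: "(\<integral>\<^sup>+t. ennreal (f t * indicator S t) \<partial>M) = ennreal F"
    using f unfolding F_def set_lebesgue_integral_def set_integrable_def
    by (subst nn_integral_eq_integral) (auto simp: indicator_def mult.commute)
  have nnh: "(\<integral>\<^sup>+t. ennreal (h t * indicator S t) \<partial>M) = ennreal (LINT t:S|M. h t)"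
    using h unfolding set_lebesgue_integral_def set_integrable_def
    by (subst nn_integral_eq_integral) (auto simp: indicator_def mult.commute less_imp_le)
  have [measurable]: "(\<lambda>t. h t * indicator S t) \<in> borel_measurable M"
    "(\<lambda>t. f t * indicator S t) \<in> borel_measurable M"
    using h f unfolding set_integrable_def by (auto simp: mult.commute)
  note [measurable] = meas
  show ?thesis
  proof (cases "F = 0")
    case True
    then show ?thesis by (simp add: F_def[symmetric])
  next
    case False
    with F0 have F: "F > 0" by simp
    \<comment> \<open>The tangent is taken at \<open>m * h\<close>, whose integral is at most \<open>F\<close>.\<close>
    define m where "m = F / U"
    have m: "m > 0" using F U by (simp add: m_def)
    have pt: "ennreal p * ennreal (f t * indicator S t) \<le>
       ennreal ((p - 1) * m) * ennreal (h t * indicator S t)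
       + ennreal (m powr (1 - p)) * (ennreal (f t powr p * h t powr (1 - p)) * indicator S t)" for t
    proof (cases "t \<in> S")
      case True
      have "p * f t \<le> (p - 1) * (h t * m) + f t powr p * (h t * m) powr (1 - p)"
        by (rule powr_tangent_line) (use p f h m True in auto)
      also have "\<dots> = (p - 1) * m * h t + m powr (1 - p) * (f t powr p * h t powr (1 - p))"
        using m h True by (simp add: powr_mult less_imp_le)
      finally have "ennreal (p * f t) \<le> ennreal ((p - 1) * m * h t + m powr (1 - p) * (f t powr p * h t powr (1 - p)))"
        by (rule ennreal_leI)
      then show ?thesis
        using p m h f True
        by (simp add: ennreal_mult less_imp_le)
    qed auto
    have "ennreal p * ennreal F = (\<integral>\<^sup>+t. ennreal p * ennreal (f t * indicator S t) \<partial>M)"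
      by (subst nn_integral_cmult) (auto simp: nnf)
    also have "\<dots> \<le> (\<integral>\<^sup>+t. ennreal ((p - 1) * m) * ennreal (h t * indicator S t)
       + ennreal (m powr (1 - p)) * (ennreal (f t powr p * h t powr (1 - p)) * indicator S t) \<partial>M)"
      by (intro nn_integral_mono pt)
    also have "\<dots> = ennreal ((p - 1) * m) * ennreal (LINT t:S|M. h t) + ennreal (m powr (1 - p)) * Y"
      unfolding Y_def by (subst nn_integral_add) (auto simp: nn_integral_cmult nnh)
    also have "\<dots> \<le> ennreal ((p - 1) * m) * ennreal U + ennreal (m powr (1 - p)) * Y"
      by (intro add_right_mono mult_left_mono ennreal_leI hU) auto
    also have "ennreal ((p - 1) * m) * ennreal U = ennreal ((p - 1) * F)"
      using p F U by (simp add: ennreal_mult[symmetric] m_def)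
    \<comment> \<open>The finite term \<open>(p - 1) * F\<close> cancels, which leaves one of the \<open>p\<close> copies of \<open>F\<close>.\<close>
    finally have "ennreal ((p - 1) * F + F) \<le> ennreal ((p - 1) * F) + ennreal (m powr (1 - p)) * Y"
      using p F by (simp add: ennreal_mult[symmetric] algebra_simps)
    then have "ennreal ((p - 1) * F) + ennreal F \<le> ennreal ((p - 1) * F) + ennreal (m powr (1 - p)) * Y"
      using p F by (subst (asm) ennreal_plus) auto
    then have "ennreal F \<le> ennreal (m powr (1 - p)) * Y"
      by (simp add: ennreal_add_left_cancel_le)
    then have "ennreal (F powr (p - 1)) * ennreal F \<le> ennreal (F powr (p - 1)) * (ennreal (m powr (1 - p)) * Y)"
      by (rule mult_left_mono) auto
    also have "\<dots> = ennreal (F powr (p - 1) * m powr (1 - p)) * Y"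
      by (simp add: ennreal_mult mult.assoc)
    also have "F powr (p - 1) * m powr (1 - p) = U powr (p - 1)"
    proof -
      have "m powr (1 - p) = F powr (1 - p) * U powr (p - 1)"
        using F U powr_minus_divide[of U "p - 1"] by (simp add: m_def powr_divide)
      then show ?thesis using F by (simp add: powr_add[symmetric] mult.assoc[symmetric])
    qed
    also have "ennreal (F powr (p - 1)) * ennreal F = ennreal (F powr p)"
      using F powr_add[of F "p - 1" 1] by (simp add: ennreal_mult[symmetric])
    finally show ?thesis by (simp add: F_def Y_def)
  qed
qed

lemma sigma_finite_lebesgue:
  "sigma_finite_measure (lebesgue :: 'a::euclidean_space measure)"
proof
  obtain A :: "'a set set" where A: "countable A" "A \<subseteq> sets lborel" "\<Union>A = space lborel"
      "\<forall>a\<in>A. emeasure lborel a \<noteq> \<infinity>"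
    using lborel.sigma_finite_countable by blast
  then show "\<exists>A::'a set set. countable A \<and> A \<subseteq> sets lebesgue \<and> \<Union>A = space lebesgue \<and> (\<forall>a\<in>A. emeasure lebesgue a \<noteq> \<infinity>)"
    by (intro exI[of _ A]) (auto simp: subset_iff)
qed

lemma Lp_on_set_integrable:
  assumes "p > 1" "f \<in> Lp_on p {a..b}"
  shows "set_integrable lebesgue {a..b} f"
proof (rule set_integrable_bound)
  show "set_integrable lebesgue {a..b} (\<lambda>x. 1 + \<bar>f x\<bar> powr p)"
  proof (rule set_integral_add(1))
    show "set_integrable lebesgue {a..b} (\<lambda>x. 1 :: real)"
      by (rule absolutely_integrable_continuous_real) simp
    show "set_integrable lebesgue {a..b} (\<lambda>x. \<bar>f x\<bar> powr p)"
      using assms by (simp add: Lp_on_def)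
  qed
  show "set_borel_measurable lebesgue {a..b} f"
    using assms by (simp add: Lp_on_def)
  \<comment> \<open>On a bounded interval \<open>L\<^sup>p\<close> is contained in \<open>L\<^sup>1\<close>.\<close>
  have "\<bar>y\<bar> \<le> 1 + \<bar>y\<bar> powr p" for y :: real
  proof (cases "\<bar>y\<bar> \<le> 1")
    case True
    then show ?thesis by (smt (verit) powr_ge_zero)
  next
    case False
    then have "\<bar>y\<bar> powr 1 \<le> \<bar>y\<bar> powr p" using assms by (intro powr_mono) auto
    then show ?thesis using False by simp
  qed
  then show "AE x in lebesgue. x \<in> {a..b} \<longrightarrow> norm (f x) \<le> norm (1 + \<bar>f x\<bar> powr p)"
    by (intro AE_I2) (simp add: abs_of_nonneg)
qed

text \<open>Jensen's inequality bounds \<open>F x powr p\<close> by \<open>U x powr (p - 1)\<close> times an integral of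
\<open>f powr p * h powr (1 - p)\<close> over \<open>{a..x}\<close>. After multiplication by \<open>x powr (-p)\<close> and exchange of the
integrals, the weight in front of \<open>f t powr p\<close> is \<open>h t powr (1 - p)\<close> times the integral that the
last hypothesis bounds, hence at most \<open>D\<close>.\<close>

lemma schur_test_hardy:
  fixes h U :: "real \<Rightarrow> real"
  assumes p: "p > 1" and a: "0 < a" and D: "0 \<le> D"
    and h: "continuous_on {a..b} h" "\<And>t. t \<in> {a..b} \<Longrightarrow> 0 < h t"
    and U: "continuous_on {a..b} U" "\<And>t. t \<in> {a..b} \<Longrightarrow> 0 < U t"
    and hU: "\<And>x. x \<in> {a..b} \<Longrightarrow> integral {a..x} h \<le> U x"
    and UD: "\<And>t. t \<in> {a..b} \<Longrightarrow>
      integral {t..b} (\<lambda>x. x powr (-p) * U x powr (p - 1)) \<le> D * h t powr (p - 1)"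
  shows "hardy_bound p a b D"
  unfolding hardy_bound_def
proof (intro ballI impI)
  fix f assume f: "f \<in> Lp_on p {a..b}" and "\<forall>x\<in>{a..b}. 0 \<le> f x"
  then have f0: "0 \<le> f x" if "a \<le> x" "x \<le> b" for x using that by auto
  define V where "V x = x powr (-p) * U x powr (p - 1)" for x
  have V0: "0 \<le> V x" for x by (simp add: V_def)
  have Vc: "continuous_on {a..b} V"
    unfolding V_def using a U p by (intro continuous_intros) (auto simp: less_imp_neq[symmetric])
  define Q where "Q t = ennreal (f t powr p * h t powr (1 - p)) * indicator {a..b} t" for t
  have fint: "set_integrable lebesgue {a..b} f"
    using p f by (rule Lp_on_set_integrable)
  have [measurable]: "(\<lambda>t. indicator {a..b} t * f t) \<in> borel_measurable lebesgue"
    using fint by (auto simp: set_integrable_def)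
  have [measurable]: "(\<lambda>x::real. x) \<in> borel_measurable lebesgue"
    by (rule measurable_completion) auto
  have "continuous_on {a..b} (\<lambda>t. h t powr (1 - p))"
    using h by (intro continuous_intros) (auto simp: less_imp_neq[symmetric])
  then have "(\<lambda>t. indicator {a..b} t *\<^sub>R h t powr (1 - p)) \<in> borel_measurable borel"
    by (intro borel_measurable_continuous_on_indicator) auto
  then have [measurable]: "(\<lambda>t. indicator {a..b} t * h t powr (1 - p)) \<in> borel_measurable lebesgue"
    by (auto intro: measurable_completion)
  have Qm[measurable]: "Q \<in> borel_measurable lebesgue"
  proof -
    have "Q = (\<lambda>t. ennreal ((indicator {a..b} t * f t) powr p * (indicator {a..b} t * h t powr (1 - p))))"
      by (auto simp: Q_def fun_eq_iff indicator_def)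
    also have "\<dots> \<in> borel_measurable lebesgue" by measurable
    finally show ?thesis .
  qed
  have "(\<lambda>x. indicator {a..b} x *\<^sub>R V x) \<in> borel_measurable borel"
    using Vc by (intro borel_measurable_continuous_on_indicator) auto
  then have Vm[measurable]: "(\<lambda>x. indicator {a..b} x * V x) \<in> borel_measurable lebesgue"
    by (auto intro: measurable_completion)
  have Fbound: "ennreal (hardy_avg a f x powr p) \<le> ennreal (V x) * (\<integral>\<^sup>+t. Q t * indicator {..x} t \<partial>lebesgue)"
    if x: "x \<in> {a..b}" for x
  proof -
    have sub: "{a..x} \<subseteq> {a..b}" using x by auto
    have hx: "continuous_on {a..x} h" using h(1) sub by (rule continuous_on_subset)
    have hi: "set_integrable lebesgue {a..x} h"
      using hx by (rule absolutely_integrable_continuous_real)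
    have eq: "(\<lambda>t. ennreal (f t powr p * h t powr (1 - p)) * indicator {a..x} t) = (\<lambda>t. Q t * indicator {..x} t)"
      using x by (auto simp: Q_def fun_eq_iff indicator_def)
    have "ennreal ((LINT t:{a..x}|lebesgue. f t) powr p)
      \<le> ennreal (U x powr (p - 1)) * (\<integral>\<^sup>+t. ennreal (f t powr p * h t powr (1 - p)) * indicator {a..x} t \<partial>lebesgue)"
    proof (rule powr_integral_le_weighted)
      show "set_integrable lebesgue {a..x} f"
        using fint by (rule set_integrable_subset) (use sub in auto)
      show "(LINT t:{a..x}|lebesgue. h t) \<le> U x"
        using hU[OF x] set_lebesgue_integral_eq_integral(2)[OF hi] by simp
      show "(\<lambda>t. ennreal (f t powr p * h t powr (1 - p)) * indicator {a..x} t) \<in> borel_measurable lebesgue"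
        unfolding eq by measurable
    qed (use p U x f0 h hi in auto)
    then have "ennreal (x powr (-p)) * ennreal ((LINT t:{a..x}|lebesgue. f t) powr p)
      \<le> ennreal (x powr (-p)) * (ennreal (U x powr (p - 1)) * (\<integral>\<^sup>+t. Q t * indicator {..x} t \<partial>lebesgue))"
      unfolding eq by (rule mult_left_mono) auto
    also have "\<dots> = ennreal (V x) * (\<integral>\<^sup>+t. Q t * indicator {..x} t \<partial>lebesgue)"
      by (simp add: V_def ennreal_mult mult.assoc)
    also have "ennreal (x powr (-p)) * ennreal ((LINT t:{a..x}|lebesgue. f t) powr p) = ennreal (hardy_avg a f x powr p)"
    proof -
      have "0 \<le> (LINT t:{a..x}|lebesgue. f t)"
        unfolding set_lebesgue_integral_def
        using x by (intro integral_nonneg_AE AE_I2) (auto simp: indicator_def f0)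
      then show ?thesis
        using x a by (simp add: hardy_avg_def ennreal_mult[symmetric] powr_divide powr_minus_divide)
    qed
    finally show ?thesis .
  qed
  have inner: "(\<integral>\<^sup>+x. ennreal (indicator {a..b} x * V x) * indicator {t..} x \<partial>lebesgue) \<le> ennreal (D * h t powr (p - 1))"
    if t: "t \<in> {a..b}" for t
  proof -
    have Vt: "continuous_on {t..b} V" by (rule continuous_on_subset[OF Vc]) (use t in auto)
    have Vi: "set_integrable lebesgue {t..b} V" using Vt by (rule absolutely_integrable_continuous_real)
    have "(\<integral>\<^sup>+x. ennreal (indicator {a..b} x * V x) * indicator {t..} x \<partial>lebesgue)
        = (\<integral>\<^sup>+x. ennreal (indicator {t..b} x * V x) \<partial>lebesgue)"
      using t by (intro nn_integral_cong) (auto simp: indicator_def)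
    also have "\<dots> = ennreal (LINT x:{t..b}|lebesgue. V x)"
      using Vi V0 unfolding set_lebesgue_integral_def set_integrable_def
      by (subst nn_integral_eq_integral) (auto simp: indicator_def)
    also have "\<dots> \<le> ennreal (D * h t powr (p - 1))"
      using UD[OF t] set_lebesgue_integral_eq_integral(2)[OF Vi] by (intro ennreal_leI) (simp add: V_def[abs_def])
    finally show ?thesis .
  qed
  interpret L: sigma_finite_measure "lebesgue :: real measure" by (rule sigma_finite_lebesgue)
  interpret P: pair_sigma_finite "lebesgue :: real measure" "lebesgue :: real measure" ..
  have fp0: "0 \<le> (LINT x:{a..b}|lebesgue. f x powr p)"
    unfolding set_lebesgue_integral_def
    by (intro integral_nonneg_AE AE_I2) auto
  have "set_integrable lebesgue {a..b} (\<lambda>x. \<bar>f x\<bar> powr p)"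
    using f by (simp add: Lp_on_def)
  then have fpi: "integrable lebesgue (\<lambda>x. indicator {a..b} x *\<^sub>R f x powr p)"
    unfolding set_integrable_def
    by (rule Bochner_Integration.integrable_cong[THEN iffD1, rotated -1]) (auto simp: indicator_def f0)
  have meas2: "(\<lambda>(x, t). ennreal (indicator {a..b} x * V x) * (Q t * indicator {..x} t))
      \<in> borel_measurable (lebesgue \<Otimes>\<^sub>M lebesgue)"
  proof -
    have "(\<lambda>(x, t). ennreal (indicator {a..b} x * V x) * (Q t * indicator {..x} t))
        = (\<lambda>z. ennreal (indicator {a..b} (fst z) * V (fst z)) * (Q (snd z) * (if snd z \<le> fst z then 1 else 0)))"
      by (auto simp: fun_eq_iff indicator_def)
    also have "\<dots> \<in> borel_measurable (lebesgue \<Otimes>\<^sub>M lebesgue)"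
      by measurable
    finally show ?thesis .
  qed
  have "(\<integral>\<^sup>+x. ennreal (indicator {a..b} x *\<^sub>R hardy_avg a f x powr p) \<partial>lebesgue)
     \<le> (\<integral>\<^sup>+x. ennreal (indicator {a..b} x * V x) * (\<integral>\<^sup>+t. Q t * indicator {..x} t \<partial>lebesgue) \<partial>lebesgue)"
    by (intro nn_integral_mono) (use Fbound in \<open>auto simp: indicator_def\<close>)
  also have "\<dots> = (\<integral>\<^sup>+x. (\<integral>\<^sup>+t. ennreal (indicator {a..b} x * V x) * (Q t * indicator {..x} t) \<partial>lebesgue) \<partial>lebesgue)"
    by (intro nn_integral_cong nn_integral_cmult[symmetric]) measurable
  also have "\<dots> = (\<integral>\<^sup>+t. (\<integral>\<^sup>+x. ennreal (indicator {a..b} x * V x) * (Q t * indicator {..x} t) \<partial>lebesgue) \<partial>lebesgue)"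
    by (rule P.Fubini'[OF meas2, symmetric])
  also have "\<dots> = (\<integral>\<^sup>+t. (\<integral>\<^sup>+x. Q t * (ennreal (indicator {a..b} x * V x) * indicator {t..} x) \<partial>lebesgue) \<partial>lebesgue)"
    by (intro nn_integral_cong) (auto simp: indicator_def mult_ac)
  also have "\<dots> = (\<integral>\<^sup>+t. Q t * (\<integral>\<^sup>+x. (ennreal (indicator {a..b} x * V x) * indicator {t..} x) \<partial>lebesgue) \<partial>lebesgue)"
    by (intro nn_integral_cong nn_integral_cmult) measurable
  also have "\<dots> \<le> (\<integral>\<^sup>+t. Q t * ennreal (D * h t powr (p - 1)) \<partial>lebesgue)"
  proof (intro nn_integral_mono)
    fix t :: real
    show "Q t * (\<integral>\<^sup>+x. (ennreal (indicator {a..b} x * V x) * indicator {t..} x) \<partial>lebesgue) \<le> Q t * ennreal (D * h t powr (p - 1))"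
      by (cases "t \<in> {a..b}") (auto intro!: mult_left_mono inner simp: Q_def)
  qed
  also have "\<dots> = (\<integral>\<^sup>+t. ennreal D * ennreal (indicator {a..b} t *\<^sub>R f t powr p) \<partial>lebesgue)"
  proof (intro nn_integral_cong)
    fix t :: real
    show "Q t * ennreal (D * h t powr (p - 1)) = ennreal D * ennreal (indicator {a..b} t *\<^sub>R f t powr p)"
    proof (cases "t \<in> {a..b}")
      case True
      then have "h t powr (1 - p) * h t powr (p - 1) = 1"
        using h(2)[of t] by (simp add: powr_add[symmetric])
      then have "f t powr p * h t powr (1 - p) * (D * h t powr (p - 1)) = D * f t powr p"
        by (simp add: mult_ac)
      then show ?thesis using True D by (simp add: Q_def ennreal_mult[symmetric])
    qed (simp add: Q_def)
  qed
  also have "\<dots> = ennreal D * ennreal (LINT x:{a..b}|lebesgue. f x powr p)"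
    using fpi unfolding set_lebesgue_integral_def
    by (subst nn_integral_cmult) (auto simp: nn_integral_eq_integral)
  also have "\<dots> = ennreal (D * (LINT x:{a..b}|lebesgue. f x powr p))"
    using D fp0 by (simp add: ennreal_mult)
  finally show "(LINT x:{a..b}|lebesgue. hardy_avg a f x powr p) \<le> D * (LINT x:{a..b}|lebesgue. f x powr p)"
    using D fp0 unfolding set_lebesgue_integral_def by (intro integral_real_bounded) auto
qed

section \<open>Hardy inequalities from a Riccati inequality\<close>

text \<open>The weight for the Schur test comes from the logarithmic derivative \<open>v = w powr (1 / (p - 1))\<close>: take
\<open>u = exp (\<integral> v)\<close> and \<open>h = u' = v * u\<close>. The Riccati inequality says precisely that
\<open>K = w * u powr (p - 1) = h powr (p - 1)\<close> satisfies \<open>- K' \<ge> l * x powr (-p) * u powr (p - 1)\<close>, and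
integrating this from \<open>t\<close> to \<open>b\<close> is the bound required there, with \<open>D = 1 / l\<close>.\<close>

lemma hardy_bound_of_riccati:
  fixes w w' :: "real \<Rightarrow> real"
  assumes p: "p > 1" and a: "0 < a" and l: "l > 0"
    and w0: "\<And>x. x \<in> {a..b} \<Longrightarrow> 0 < w x"
    and dw: "\<And>x. x \<in> {a..b} \<Longrightarrow> (w has_real_derivative w' x) (at x within {a..b})"
    and ric: "\<And>x. x \<in> {a..b} \<Longrightarrow> w' x + (p - 1) * w x powr (p / (p - 1)) + l * x powr (-p) \<le> 0"
  shows "hardy_bound p a b (1 / l)"
proof -
  define v where "v x = w x powr (1 / (p - 1))" for x
  define W where "W x = integral {a..x} v" for x
  define u where "u x = exp (W x)" for x
  have wc: "continuous_on {a..b} w"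
    using dw by (rule DERIV_continuous_on)
  have vc: "continuous_on {a..b} v"
    unfolding v_def using wc w0 by (intro continuous_intros) (auto simp: less_imp_neq[symmetric])
  have dW: "(W has_real_derivative v x) (at x within {a..b})" if "x \<in> {a..b}" for x
    unfolding W_def using integral_has_real_derivative[OF vc that] .
  have du: "(u has_real_derivative v x * u x) (at x within {a..b})" if "x \<in> {a..b}" for x
    unfolding u_def by (auto intro!: derivative_eq_intros dW that)
  have uc: "continuous_on {a..b} u"
    using du by (rule DERIV_continuous_on)
  define K where "K x = w x * exp ((p - 1) * W x)" for x
  define K' where "K' x = (w' x + (p - 1) * w x powr (p / (p - 1))) * exp ((p - 1) * W x)" for x
  have dK: "(K has_real_derivative K' x) (at x within {a..b})" if x: "x \<in> {a..b}" for x
  proof -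
    have "w x powr (p / (p - 1)) = w x powr (1 + 1 / (p - 1))"
      using p by (simp add: field_simps)
    also have "\<dots> = w x * v x"
      using w0[OF x] by (simp add: powr_add v_def)
    finally have "K' x = w' x * exp ((p - 1) * W x) + w x * (exp ((p - 1) * W x) * ((p - 1) * v x))"
      by (simp add: K'_def algebra_simps)
    then show ?thesis
      unfolding K_def by (auto intro!: derivative_eq_intros dW dw x)
  qed
  have upow: "u x powr (p - 1) = exp ((p - 1) * W x)" for x
    by (simp add: u_def powr_def)
  show ?thesis
  proof (rule schur_test_hardy[where h = "\<lambda>x. v x * u x" and U = u])
    show "continuous_on {a..b} (\<lambda>x. v x * u x)"
      by (intro continuous_intros vc uc)
    show "continuous_on {a..b} u" by (rule uc)
    show "0 < v t * u t" if "t \<in> {a..b}" for t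
      using w0[OF that] by (simp add: v_def u_def)
    show "integral {a..x} (\<lambda>x. v x * u x) \<le> u x" if x: "x \<in> {a..b}" for x
    proof -
      have "((\<lambda>x. v x * u x) has_integral (u x - u a)) {a..x}"
        using x by (intro fundamental_theorem_of_calculus)
          (auto intro!: DERIV_subset[OF du] simp: has_real_derivative_iff_has_vector_derivative[symmetric])
      then show ?thesis by (simp add: integral_unique u_def)
    qed
    show "integral {t..b} (\<lambda>x. x powr (-p) * u x powr (p - 1)) \<le> 1 / l * (v t * u t) powr (p - 1)"
      if t: "t \<in> {a..b}" for t
    proof -
      have 1: "((\<lambda>x. - K' x) has_integral (- K b - (- K t))) {t..b}"
        using t by (intro fundamental_theorem_of_calculus)
          (auto intro!: DERIV_subset[OF dK] DERIV_minus simp: has_real_derivative_iff_has_vector_derivative[symmetric])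
      have "continuous_on {t..b} (\<lambda>x. x powr (-p) * u x powr (p - 1))"
        using a t by (intro continuous_intros continuous_on_subset[OF uc]) (auto simp: u_def)
      then have 2: "(\<lambda>x. x powr (-p) * u x powr (p - 1)) integrable_on {t..b}"
        by (rule integrable_continuous_real)
      have "l * integral {t..b} (\<lambda>x. x powr (-p) * u x powr (p - 1))
          = integral {t..b} (\<lambda>x. l * (x powr (-p) * u x powr (p - 1)))"
        by simp
      also have "\<dots> \<le> integral {t..b} (\<lambda>x. - K' x)"
      proof (rule integral_le)
        show "(\<lambda>x. - K' x) integrable_on {t..b}"
          using 1 by (rule has_integral_integrable)
        show "(\<lambda>x. l * (x powr (-p) * u x powr (p - 1))) integrable_on {t..b}"
          using integrable_on_cmult_left[OF 2, of l] by simp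
        fix x assume "x \<in> {t..b}"
        then have "(l * x powr (-p)) * exp ((p - 1) * W x)
            \<le> (- (w' x + (p - 1) * w x powr (p / (p - 1)))) * exp ((p - 1) * W x)"
          using ric[of x] t by (intro mult_right_mono) auto
        then show "l * (x powr (-p) * u x powr (p - 1)) \<le> - K' x"
          by (simp add: upow K'_def algebra_simps)
      qed
      also have "\<dots> = K t - K b"
        using integral_unique[OF 1] by simp
      also have "\<dots> \<le> K t"
        using w0[of b] t by (simp add: K_def)
      also have "K t = (v t * u t) powr (p - 1)"
        using w0[OF t] p by (simp add: K_def powr_mult upow v_def powr_powr)
      finally show ?thesis
        using l by (simp add: field_simps)
    qed
  qed (use p a l in \<open>auto simp: u_def\<close>)
qed

text \<open>A second order Taylor bound at 1 that is valid for all \<open>y \<ge> 1\<close>. The restriction \<open>q \<le> 2\<close> is what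
allows a quadratic remainder for large \<open>y\<close>; in the application \<open>q = p / (p - 1)\<close>, so it amounts to
\<open>p \<ge> 2\<close>.\<close>

lemma powr_le_quadratic:
  fixes q y :: real
  assumes "1 \<le> q" "q \<le> 2" "1 \<le> y"
  shows "y powr q \<le> 1 + q * (y - 1) + (q - 1) * (y - 1)\<^sup>2"
proof -
  have "y powr q = y * y powr (q - 1)"
    using assms powr_add[of y 1 "q - 1"] by simp
  also have "y powr (q - 1) \<le> (q - 1) * y + (2 - q)"
    using Youngs_inequality_0[of "q - 1" "2 - q" y 1] assms by simp
  then have "y * y powr (q - 1) \<le> y * ((q - 1) * y + (2 - q))"
    using assms by (intro mult_left_mono) auto
  also have "\<dots> = 1 + q * (y - 1) + (q - 1) * (y - 1)\<^sup>2"
    by (simp add: power2_eq_square algebra_simps)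
  finally show ?thesis .
qed

text \<open>The solution of the Riccati inequality is \<open>w = x powr (1 - p) * g x\<close>, where \<open>g\<close> is the constant
\<open>g0\<close> plus a function decreasing linearly in \<open>ln x\<close> to 0 at \<open>b\<close>. The constant \<open>g0\<close> maximizes
\<open>y - y powr q\<close>, so the first order term of the perturbation \<open>s = g - g0\<close> cancels and its cost is
\<open>(p - 1) / (p * g0) * s\<^sup>2 \<le> (p - 1) / (p * g0) * d\<^sup>2 / L\<^sup>2\<close>, against a gain \<open>d / L\<^sup>2\<close> from the
derivative. The value of \<open>d\<close> maximizes the net gain, which is then \<open>d / (2 * L\<^sup>2)\<close>.\<close>

lemma hardy_bound_log_improved:
  fixes p a b :: real
  assumes p: "2 \<le> p" and ab: "0 < a" "a < b"
  shows "hardy_bound p a b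
    ((p / (p - 1)) powr p * inverse (1 + (p / (p - 1))\<^sup>2 / 4 / (ln (b / a))\<^sup>2))"
proof -
  define L where "L = ln (b / a)"
  define q where "q = p / (p - 1)"
  define g0 where "g0 = ((p - 1) / p) powr (p - 1)"
  define d where "d = p * g0 / (2 * (p - 1))"
  define g where "g x = g0 + d * (L - ln (x / a)) / L\<^sup>2" for x
  define l where "l = (p - 1) / p * g0 + d / (2 * L\<^sup>2)"
  have L: "L > 0" using ab by (simp add: L_def)
  have g0: "g0 > 0" using p by (simp add: g0_def)
  have d: "d > 0" using p g0 by (simp add: d_def)
  have l: "l > 0" using p g0 d L by (simp add: l_def add_pos_pos)
  have q: "1 \<le> q" "q \<le> 2" using p by (auto simp: q_def field_simps)
  have g0q: "g0 powr q = g0 * ((p - 1) / p)"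
  proof -
    have "g0 powr q = ((p - 1) / p) powr ((p - 1) + 1)"
      using p by (simp add: g0_def powr_powr q_def)
    then show ?thesis
      using p powr_add[of "(p - 1) / p" "p - 1" 1] by (simp add: g0_def)
  qed
  have g_ge: "g x \<ge> g0" and s_le: "g x - g0 \<le> d / L" if "x \<in> {a..b}" for x
  proof -
    have "ln (x / a) \<le> L" "0 \<le> ln (x / a)" using that ab by (auto simp: L_def intro: divide_right_mono)
    then have *: "0 \<le> d * (L - ln (x / a)) / L\<^sup>2" "d * (L - ln (x / a)) / L\<^sup>2 \<le> d * L / L\<^sup>2"
      using d by (auto intro!: divide_right_mono)
    then show "g x \<ge> g0" "g x - g0 \<le> d / L" using L by (auto simp: g_def power2_eq_square)
  qed
  have key: "(p - 1) * (g x powr q - g x) \<le> - ((p - 1) / p * g0) + d / (2 * L\<^sup>2)"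
    if x: "x \<in> {a..b}" for x
  proof -
    define s where "s = g x - g0"
    have s: "0 \<le> s" "s \<le> d / L" using g_ge[OF x] s_le[OF x] by (auto simp: s_def)
    have "g x powr q = (g0 * (1 + s / g0)) powr q"
      using g0 by (simp add: s_def field_simps)
    also have "\<dots> = g0 powr q * (1 + s / g0) powr q"
      using g0 s by (simp add: powr_mult)
    also have "\<dots> \<le> g0 powr q * (1 + q * (s / g0) + (q - 1) * (s / g0)\<^sup>2)"
      using powr_le_quadratic[OF q, of "1 + s / g0"] g0 s by (intro mult_left_mono) auto
    also have "\<dots> = g0 * ((p - 1) / p) + s + s\<^sup>2 / (p * g0)"
    proof -
      have "(p - 1) / p * q = 1" "(p - 1) / p * (q - 1) = 1 / p"
        using p by (auto simp: q_def field_simps)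
      moreover have "g0 powr q * (1 + q * (s / g0) + (q - 1) * (s / g0)\<^sup>2)
          = g0 * ((p - 1) / p) + ((p - 1) / p * q) * (g0 * (s / g0))
            + ((p - 1) / p * (q - 1)) * (g0 * (s / g0)\<^sup>2)"
        unfolding g0q by (simp only: distrib_left mult_ac mult_1_right)
      ultimately show ?thesis
        using g0 by (simp add: power2_eq_square)
    qed
    finally have "(p - 1) * (g x powr q - g x) \<le> (p - 1) * (g0 * ((p - 1) / p) + s + s\<^sup>2 / (p * g0) - (g0 + s))"
      using p by (intro mult_left_mono) (auto simp: s_def)
    also have "\<dots> = - ((p - 1) / p * g0) + (p - 1) / (p * g0) * s\<^sup>2"
      using p g0 by (simp add: field_simps)
    also have "(p - 1) / (p * g0) * s\<^sup>2 \<le> (p - 1) / (p * g0) * (d / L)\<^sup>2"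
      using s p g0 by (intro mult_left_mono power_mono) auto
    also have "(p - 1) / (p * g0) * (d / L)\<^sup>2 = d / (2 * L\<^sup>2)"
    proof -
      have "(p - 1) / (p * g0) * d = 1 / 2"
        using p g0 by (simp add: d_def field_simps)
      then have "((p - 1) / (p * g0) * d) * d / L\<^sup>2 = 1 / 2 * d / L\<^sup>2"
        by (simp only:)
      then show ?thesis
        by (simp add: power2_eq_square)
    qed
    finally show ?thesis by simp
  qed
  have "hardy_bound p a b (1 / l)"
  proof (rule hardy_bound_of_riccati)
    fix x assume x: "x \<in> {a..b}"
    have x0: "x > 0" using x ab by simp
    have gx: "g x > 0" using g_ge[OF x] g0 by simp
    show "0 < x powr (1 - p) * g x" using x0 gx by simp
    have e: "x powr (1 - p) = x powr (-p) * x" "x powr (1 - p - 1) = x powr (-p)"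
      using x0 powr_add[of x "-p" 1] by auto
    have "(g has_real_derivative - d / (L\<^sup>2 * x)) (at x within {a..b})"
      unfolding g_def using x0 ab L by (auto intro!: derivative_eq_intros simp: field_simps)
    then show "((\<lambda>x. x powr (1 - p) * g x) has_real_derivative x powr (-p) * ((1 - p) * g x - d / L\<^sup>2)) (at x within {a..b})"
      using x0 L by (auto intro!: derivative_eq_intros DERIV_fun_powr simp: e field_simps)
    have "(1 - p) * q = - p"
      using p by (simp add: q_def field_simps)
    then have "(x powr (1 - p) * g x) powr q = x powr (-p) * g x powr q"
      using x0 gx by (simp add: powr_mult powr_powr)
    then have "x powr (-p) * ((1 - p) * g x - d / L\<^sup>2) + (p - 1) * (x powr (1 - p) * g x) powr q + l * x powr (-p)
       = x powr (-p) * ((p - 1) * (g x powr q - g x) - d / L\<^sup>2 + l)"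
      by (simp add: algebra_simps)
    also have "\<dots> \<le> 0"
      using key[OF x] by (intro mult_nonneg_nonpos) (auto simp: l_def)
    finally show "x powr (-p) * ((1 - p) * g x - d / L\<^sup>2) + (p - 1) * (x powr (1 - p) * g x) powr (p / (p - 1)) + l * x powr (-p) \<le> 0"
      by (simp add: q_def)
  qed (use p ab l in auto)
  also have "1 / l = (p / (p - 1)) powr p * inverse (1 + (p / (p - 1))\<^sup>2 / 4 / L\<^sup>2)"
  proof -
    \<comment> \<open>The unperturbed value of \<open>l\<close> is \<open>(p - 1) / p * g0\<close>, the inverse of the classical constant,
      and the gain \<open>d / (2 * L\<^sup>2)\<close> is the fraction \<open>q\<^sup>2 / 4 / L\<^sup>2\<close> of it.\<close>
    have "(p - 1) / p * g0 = ((p - 1) / p) powr p"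
      using p powr_add[of "(p - 1) / p" "p - 1" 1] by (simp add: g0_def)
    also have "\<dots> = inverse ((p / (p - 1)) powr p)"
      using p by (simp add: powr_divide)
    finally have g: "inverse ((p / (p - 1)) powr p) = (p - 1) / p * g0" by simp
    have "(p - 1) / p = 1 / q" "d = q * g0 / 2"
      by (simp_all add: q_def d_def)
    then have "l = 1 / q * g0 + q * g0 / 2 / (2 * L\<^sup>2)"
      by (simp only: l_def)
    also have "\<dots> = 1 / q * g0 * (1 + q\<^sup>2 / 4 / L\<^sup>2)"
      using q by (simp add: distrib_left power2_eq_square)
    finally have "l = (p - 1) / p * g0 * (1 + (p / (p - 1))\<^sup>2 / 4 / L\<^sup>2)"
      by (simp add: q_def)
    also have "\<dots> = inverse ((p / (p - 1)) powr p) * (1 + (p / (p - 1))\<^sup>2 / 4 / L\<^sup>2)"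
      by (simp only: g)
    finally have l_eq: "l = inverse ((p / (p - 1)) powr p) * (1 + (p / (p - 1))\<^sup>2 / 4 / L\<^sup>2)" .
    show ?thesis
      by (simp only: l_eq inverse_eq_divide[symmetric] inverse_mult_distrib inverse_inverse_eq)
  qed
  finally show ?thesis by (simp add: L_def)
qed

section \<open>The best constant\<close>

text \<open>Admissible constants are closed under infima, since each test function imposes one closed condition.
A single test function with positive norm bounds them below, so the infimum is a least element.\<close>

lemma least_hardy_bound:
  assumes fL: "f \<in> Lp_on p {a..b}" "\<forall>x\<in>{a..b}. 0 \<le> f x"
    and pos: "0 < (LINT x:{a..b}|lebesgue. f x powr p)"
    and D: "hardy_bound p a b D"
  shows hardy_bound_hardy_best: "hardy_bound p a b (hardy_best p a b)"
    and hardy_best_le: "\<And>E. hardy_bound p a b E \<Longrightarrow> hardy_best p a b \<le> E"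
proof -
  define A where "A = {D. hardy_bound p a b D}"
  have ne: "A \<noteq> {}" using D by (auto simp: A_def)
  have bdd: "bdd_below A"
  proof (rule bdd_belowI)
    fix E assume "E \<in> A"
    then have "(LINT x:{a..b}|lebesgue. hardy_avg a f x powr p) \<le> E * (LINT x:{a..b}|lebesgue. f x powr p)"
      using fL by (auto simp: A_def hardy_bound_def)
    then show "(LINT x:{a..b}|lebesgue. hardy_avg a f x powr p) / (LINT x:{a..b}|lebesgue. f x powr p) \<le> E"
      using pos by (simp add: field_simps)
  qed
  have low: "Inf A \<le> E" if "hardy_bound p a b E" for E
    using that bdd by (auto intro!: cInf_lower simp: A_def)
  have min: "hardy_bound p a b (Inf A)"
    unfolding hardy_bound_def
  proof (intro ballI impI)
    fix g assume g: "g \<in> Lp_on p {a..b}" "\<forall>x\<in>{a..b}. 0 \<le> g x"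
    let ?J = "LINT x:{a..b}|lebesgue. hardy_avg a g x powr p"
    let ?I = "LINT x:{a..b}|lebesgue. g x powr p"
    have le: "?J \<le> E * ?I" if "E \<in> A" for E
      using that g by (auto simp: A_def hardy_bound_def)
    have "0 \<le> ?I"
      unfolding set_lebesgue_integral_def by (intro integral_nonneg_AE AE_I2) auto
    then consider "?I = 0" | "?I > 0" by linarith
    then show "?J \<le> Inf A * ?I"
    proof cases
      case 1
      then show ?thesis using le D by (auto simp: A_def)
    next
      case 2
      then have "?J / ?I \<le> Inf A"
        using le by (intro cInf_greatest[OF ne]) (simp add: field_simps)
      then show ?thesis using 2 by (simp add: field_simps)
    qed
  qed
  have "hardy_best p a b = Inf A"
    unfolding hardy_best_def by (rule Least_equality) (auto intro: min low)
  then show "hardy_bound p a b (hardy_best p a b)" "\<And>E. hardy_bound p a b E \<Longrightarrow> hardy_best p a b \<le> E"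
    using min low by auto
qed

section \<open>The almost extremal function\<close>

text \<open>Existence is the intermediate value theorem for the equation multiplied by the cosine, which has
no pole at the left endpoint. Uniqueness holds because both summands increase strictly with the
unknown; the tangent is shifted by \<open>pi\<close> into its principal branch to see this.\<close>

lemma ex1_is_alpha:
  assumes p: "p > 1" and ab: "0 < a" "a < b"
  shows "\<exists>!\<alpha>. is_alpha p a b \<alpha>"
proof -
  define L where "L = ln (b / a)"
  define c where "c = p / (p - 1)"
  have L: "L > 0" using ab by (simp add: L_def)
  have c: "c > 0" using p by (simp add: c_def)
  define lo where "lo = pi / (2 * L)"
  define hi where "hi = pi / L"
  have lohi: "0 < lo" "lo < hi" using L by (auto simp: lo_def hi_def field_simps)
  have alpha_iff: "is_alpha p a b x \<longleftrightarrow> x \<in> {lo<..<hi} \<and> tan (x * L) + c * x = 0" for x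
    by (simp add: is_alpha_def L_def c_def lo_def hi_def mult_ac)
  have range: "pi / 2 < x * L" "x * L < pi" if "x \<in> {lo<..<hi}" for x
    using that L by (auto simp: lo_def hi_def field_simps)
  have "\<exists>x\<ge>lo. x \<le> hi \<and> sin (x * L) + c * x * cos (x * L) = 0"
  proof (rule IVT2')
    show "sin (hi * L) + c * hi * cos (hi * L) \<le> 0"
      using L c lohi by (simp add: hi_def)
    have "lo * L = pi / 2" using L by (simp add: lo_def)
    then show "0 \<le> sin (lo * L) + c * lo * cos (lo * L)"
      by (simp only: sin_pi_half cos_pi_half)
    show "continuous_on {lo..hi} (\<lambda>x. sin (x * L) + c * x * cos (x * L))"
      by (intro continuous_intros)
  qed (use lohi in auto)
  then obtain x where x: "lo \<le> x" "x \<le> hi" and x0: "sin (x * L) + c * x * cos (x * L) = 0"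
    by blast
  have "x \<noteq> lo"
  proof
    assume "x = lo"
    then have "x * L = pi / 2" using L by (simp add: lo_def)
    with x0 show False by simp
  qed
  moreover have "x \<noteq> hi"
  proof
    assume "x = hi"
    then have "x * L = pi" using L by (simp add: hi_def)
    with x0 c lohi \<open>x = hi\<close> show False by simp
  qed
  ultimately have xin: "x \<in> {lo<..<hi}" using x by auto
  have cosx: "cos (x * L) < 0"
    using range[OF xin] cos_gt_zero[of "pi - x * L"] by simp
  have "is_alpha p a b x"
    unfolding alpha_iff using xin x0 cosx by (simp add: tan_def field_simps)
  moreover have "y = z" if y: "is_alpha p a b y" and z: "is_alpha p a b z" for y z
  proof -
    have aux: "\<not> r < s" if r: "is_alpha p a b r" and s: "is_alpha p a b s" for r s
    proof
      assume rs: "r < s"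
      have "tan (r * L - pi) < tan (s * L - pi)"
        using range[of r] range[of s] r s rs L by (intro tan_monotone) (auto simp: alpha_iff)
      then have "tan (r * L) < tan (s * L)"
        using tan_periodic_pi[of "r * L - pi"] tan_periodic_pi[of "s * L - pi"] by simp
      moreover have "c * r < c * s" using rs c by simp
      ultimately show False using r s by (simp add: alpha_iff)
    qed
    show ?thesis using aux[OF y z] aux[OF z y] by simp
  qed
  ultimately show ?thesis by blast
qed

text \<open>The equation for \<open>\<alpha>\<close> gives \<open>sin (\<alpha> * L) = - k * C\<close> with \<open>C = cos (\<alpha> * L) < 0\<close>, hence
\<open>C = - 1 / sqrt (1 + k\<^sup>2)\<close>. The addition theorem for \<open>sin (\<alpha> * L - \<alpha> * ln (x / a))\<close> then produces
the combination of sine and cosine in the definition of \<open>f_star\<close>.\<close>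

lemma f_star_reflected:
  assumes p: "p > 1" and ab: "0 < a" "a < b" and al: "is_alpha p a b \<alpha>" and x: "0 < x"
  shows "f_star p a \<alpha> x = sqrt (1 + (\<alpha> * p / (p - 1))\<^sup>2) * x powr (-1/p) * sin (\<alpha> * ln (b / x))"
proof -
  define L where "L = ln (b / a)"
  define k where "k = \<alpha> * p / (p - 1)"
  define th where "th = \<alpha> * ln (x / a)"
  have L: "L > 0" using ab by (simp add: L_def)
  have r: "pi / 2 < \<alpha> * L" "\<alpha> * L < pi" and t: "tan (\<alpha> * L) + k = 0"
    using al L by (auto simp: is_alpha_def L_def[symmetric] k_def field_simps)
  define C where "C = cos (\<alpha> * L)"
  have C: "C < 0"
    using r cos_gt_zero[of "pi - \<alpha> * L"] by (simp add: C_def)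
  have S: "sin (\<alpha> * L) = - k * C"
    using t C by (simp add: tan_def C_def field_simps)
  have "C\<^sup>2 * (1 + k\<^sup>2) = 1"
    using sin_cos_squared_add[of "\<alpha> * L", unfolded S C_def[symmetric]]
    by (simp add: power_mult_distrib algebra_simps)
  then have "sqrt (C\<^sup>2 * (1 + k\<^sup>2)) = 1" by simp
  then have C1: "sqrt (1 + k\<^sup>2) * (- C) = 1"
    using C by (simp add: real_sqrt_mult mult.commute)
  have "\<alpha> * ln (b / x) = \<alpha> * L - th"
    using ab x by (simp add: L_def th_def ln_div algebra_simps)
  then have "sin (\<alpha> * ln (b / x)) = sin (\<alpha> * L) * cos th - cos (\<alpha> * L) * sin th"
    by (simp only: sin_diff)
  also have "\<dots> = (- C) * (k * cos th + sin th)"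
    unfolding S C_def[symmetric] by (simp add: algebra_simps)
  finally have "sqrt (1 + k\<^sup>2) * sin (\<alpha> * ln (b / x)) = (sqrt (1 + k\<^sup>2) * (- C)) * (k * cos th + sin th)"
    by (simp only: mult.assoc)
  then have "sqrt (1 + k\<^sup>2) * sin (\<alpha> * ln (b / x)) = k * cos th + sin th"
    by (simp only: C1 mult_1)
  moreover have "1 / x powr (1 / p) = x powr (-1/p)"
    by (simp add: powr_minus_divide)
  ultimately show ?thesis
    by (simp add: f_star_def k_def[symmetric] th_def[symmetric] mult_ac)
qed

text \<open>The primitive is explicit: \<open>p / (p - 1) * t powr (1 - 1/p) * sin (\<alpha> * ln (t / a))\<close> vanishes at \<open>a\<close> and
has derivative \<open>f_star p a \<alpha> t\<close>.\<close>

lemma hardy_avg_f_star: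
  assumes p: "p > 1" and a: "0 < a" and x: "a \<le> x"
  shows "hardy_avg a (f_star p a \<alpha>) x = p / (p - 1) * x powr (-1/p) * sin (\<alpha> * ln (x / a))"
proof -
  define G where "G t = p / (p - 1) * t powr (1 - 1/p) * sin (\<alpha> * ln (t / a))" for t
  have "(G has_real_derivative f_star p a \<alpha> t) (at t within {a..x})" if "t \<in> {a..x}" for t
  proof -
    have t: "t > 0" using that a by simp
    let ?s = "sin (\<alpha> * ln (t / a))" and ?c = "cos (\<alpha> * ln (t / a))"
    have e: "t powr (1 - 1/p) = t powr (-1/p) * t"
      using t powr_add[of t "-1/p" 1] by simp
    have pp: "p / (p - 1) * (1 - 1/p) = 1"
      using p by (simp add: field_simps)
    have d1: "((\<lambda>t. t powr (1 - 1/p)) has_real_derivative (1 - 1/p) * t powr (1 - 1/p - 1)) (at t within {a..x})"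
      using has_real_derivative_powr[OF t] by (rule has_field_derivative_at_within)
    have d2: "((\<lambda>t. sin (\<alpha> * ln (t / a))) has_real_derivative ?c * (\<alpha> * (1 / t))) (at t within {a..x})"
      using t a by (auto intro!: derivative_eq_intros simp: field_simps)
    have "(G has_real_derivative p / (p - 1) * ((1 - 1/p) * t powr (1 - 1/p - 1)) * ?s
        + ?c * (\<alpha> * (1 / t)) * (p / (p - 1) * t powr (1 - 1/p))) (at t within {a..x})"
      unfolding G_def by (rule DERIV_mult[OF DERIV_cmult[OF d1] d2])
    also have "p / (p - 1) * ((1 - 1/p) * t powr (1 - 1/p - 1)) * ?s
        + ?c * (\<alpha> * (1 / t)) * (p / (p - 1) * t powr (1 - 1/p))
        = (p / (p - 1) * (1 - 1/p)) * t powr (-1/p) * ?s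
        + \<alpha> * p / (p - 1) * t powr (-1/p) * ?c"
      using t by (simp add: e mult_ac)
    also have "\<dots> = f_star p a \<alpha> t"
      unfolding pp by (simp add: f_star_def powr_minus_divide distrib_left)
    finally show ?thesis .
  qed
  then have hi: "(f_star p a \<alpha> has_integral (G x - G a)) {a..x}"
    using x by (intro fundamental_theorem_of_calculus)
       (auto simp: has_real_derivative_iff_has_vector_derivative[symmetric])
  have "continuous_on {a..x} (f_star p a \<alpha>)"
    unfolding f_star_def[abs_def] using a p by (intro continuous_intros) auto
  then have "set_integrable lebesgue {a..x} (f_star p a \<alpha>)"
    by (rule absolutely_integrable_continuous_real)
  then have "(LINT t:{a..x}|lebesgue. f_star p a \<alpha> t) = G x - G a"
    using hi by (simp add: set_lebesgue_integral_eq_integral(2) integral_unique)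
  also have "G a = 0" using a by (simp add: G_def)
  finally show ?thesis
    using x a powr_add[of x "-1/p" 1] by (simp add: hardy_avg_def G_def)
qed

text \<open>Invariance of \<open>dx / x\<close> under \<open>x \<mapsto> a * b / x\<close>. If \<open>H\<close> is a primitive of \<open>S\<close>, then \<open>H (ln (x / a))\<close> and
\<open>- H (ln (b / x))\<close> are primitives of the two integrands, and both grow by \<open>H (ln (b / a)) - H 0\<close>.\<close>

lemma integral_log_reflect:
  fixes S :: "real \<Rightarrow> real"
  assumes ab: "0 < a" "a < b" and S: "continuous_on {0..ln (b / a)} S"
  shows "integral {a..b} (\<lambda>x. S (ln (b / x)) / x) = integral {a..b} (\<lambda>x. S (ln (x / a)) / x)"
proof -
  let ?L = "ln (b / a)"
  define H where "H t = integral {0..t} S" for t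
  have dH: "(H has_real_derivative S t) (at t within {0..?L})" if "t \<in> {0..?L}" for t
    unfolding H_def using integral_has_real_derivative[OF S that] .
  have "((\<lambda>x. S (ln (x / a)) / x) has_integral (H (ln (b / a)) - H (ln (a / a)))) {a..b}"
  proof (rule fundamental_theorem_of_calculus)
    fix x assume x: "x \<in> {a..b}"
    have "((\<lambda>x. H (ln (x / a))) has_real_derivative S (ln (x / a)) * (1 / x)) (at x within {a..b})"
    proof (rule DERIV_image_chain[of H _ "\<lambda>x. ln (x / a)", unfolded o_def])
      show "((\<lambda>x. ln (x / a)) has_real_derivative 1 / x) (at x within {a..b})"
        using x ab by (auto intro!: derivative_eq_intros simp: field_simps)
      show "(H has_real_derivative S (ln (x / a))) (at (ln (x / a)) within (\<lambda>x. ln (x / a)) ` {a..b})"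
        using x ab by (intro DERIV_subset[OF dH]) (auto simp: divide_right_mono)
    qed
    then show "((\<lambda>x. H (ln (x / a))) has_vector_derivative S (ln (x / a)) / x) (at x within {a..b})"
      by (simp add: has_real_derivative_iff_has_vector_derivative)
  qed (use ab in auto)
  moreover have "((\<lambda>x. S (ln (b / x)) / x) has_integral (- H (ln (b / b)) - (- H (ln (b / a))))) {a..b}"
  proof (rule fundamental_theorem_of_calculus)
    fix x assume x: "x \<in> {a..b}"
    have "((\<lambda>x. H (ln (b / x))) has_real_derivative S (ln (b / x)) * (- 1 / x)) (at x within {a..b})"
    proof (rule DERIV_image_chain[of H _ "\<lambda>x. ln (b / x)", unfolded o_def])
      show "((\<lambda>x. ln (b / x)) has_real_derivative - 1 / x) (at x within {a..b})"
        using x ab by (auto intro!: derivative_eq_intros simp: field_simps power2_eq_square)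
      show "(H has_real_derivative S (ln (b / x))) (at (ln (b / x)) within (\<lambda>x. ln (b / x)) ` {a..b})"
        using x ab by (intro DERIV_subset[OF dH]) (auto simp: divide_left_mono)
    qed
    then have "((\<lambda>x. - H (ln (b / x))) has_real_derivative S (ln (b / x)) / x) (at x within {a..b})"
      by (auto intro!: derivative_eq_intros)
    then show "((\<lambda>x. - H (ln (b / x))) has_vector_derivative S (ln (b / x)) / x) (at x within {a..b})"
      by (simp add: has_real_derivative_iff_has_vector_derivative)
  qed (use ab in auto)
  ultimately show ?thesis using ab by (simp add: integral_unique)
qed

text \<open>With \<open>S t = sin (\<alpha> * t) powr p\<close>, the two integrands are constant multiples of \<open>S (ln (b / x)) / x\<close> and
\<open>S (ln (x / a)) / x\<close>, whose integrals agree by reflection. Nonnegativity holds because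
\<open>\<alpha> * ln (b / x)\<close> stays in \<open>[0, pi]\<close>.\<close>

lemma f_star_facts:
  assumes p: "p > 1" and ab: "0 < a" "a < b" and al: "is_alpha p a b \<alpha>"
  shows f_star_Lp: "f_star p a \<alpha> \<in> Lp_on p {a..b}"
    and f_star_nonneg: "\<forall>x\<in>{a..b}. 0 \<le> f_star p a \<alpha> x"
    and f_star_norm_pos: "0 < (LINT x:{a..b}|lebesgue. f_star p a \<alpha> x powr p)"
    and f_star_quotient: "(LINT x:{a..b}|lebesgue. hardy_avg a (f_star p a \<alpha>) x powr p)
        = (p / (p - 1)) powr p * (1 + (\<alpha> * p / (p - 1))\<^sup>2) powr (- p / 2)
          * (LINT x:{a..b}|lebesgue. f_star p a \<alpha> x powr p)"
proof -
  define k where "k = \<alpha> * p / (p - 1)"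
  define R where "R = (1 + k\<^sup>2) powr (p / 2)"
  define S where "S t = sin (\<alpha> * t) powr p" for t
  let ?L = "ln (b / a)"
  have L: "?L > 0" using ab by simp
  have r: "0 < \<alpha>" "\<alpha> * ?L < pi"
  proof -
    have "0 < pi / (2 * ?L)" using L by simp
    also have "\<dots> < \<alpha>" using al by (simp add: is_alpha_def)
    finally show "0 < \<alpha>" .
    show "\<alpha> * ?L < pi" using al L by (simp add: is_alpha_def field_simps)
  qed
  have sin0: "0 \<le> sin (\<alpha> * t)" if "t \<in> {0..?L}" for t
  proof (rule sin_ge_zero)
    have "\<alpha> * t \<le> \<alpha> * ?L" using r that by (intro mult_left_mono) auto
    then show "\<alpha> * t \<le> pi" using r(2) by linarith
  qed (use r that in auto)
  have Sc: "continuous_on {0..?L} S"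
    unfolding S_def using p sin0 by (intro continuous_on_powr' continuous_intros) auto
  have logs: "ln (x / a) \<in> {0..?L}" "ln (b / x) \<in> {0..?L}" if "x \<in> {a..b}" for x
    using that ab by (auto intro: divide_right_mono divide_left_mono)
  have refl: "f_star p a \<alpha> x = sqrt (1 + k\<^sup>2) * x powr (-1/p) * sin (\<alpha> * ln (b / x))" if "x \<in> {a..b}" for x
    using f_star_reflected[OF p ab al, of x] that ab by (simp add: k_def)
  show nonneg: "\<forall>x\<in>{a..b}. 0 \<le> f_star p a \<alpha> x"
    using refl sin0 logs by auto
  have fc: "continuous_on {a..b} (f_star p a \<alpha>)"
    unfolding f_star_def[abs_def] using ab p by (intro continuous_intros) auto
  have fpc: "continuous_on {a..b} (\<lambda>x. f_star p a \<alpha> x powr p)"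
    using fc p nonneg by (intro continuous_on_powr' continuous_intros) auto
  have fpi: "set_integrable lebesgue {a..b} (\<lambda>x. f_star p a \<alpha> x powr p)"
    using fpc by (rule absolutely_integrable_continuous_real)
  have "set_integrable lebesgue {a..b} (\<lambda>x. \<bar>f_star p a \<alpha> x\<bar> powr p)"
    using fc p by (intro absolutely_integrable_continuous_real continuous_on_powr' continuous_intros) auto
  moreover have "set_borel_measurable lebesgue {a..b} (f_star p a \<alpha>)"
    using absolutely_integrable_continuous_real[OF fc] unfolding set_integrable_def set_borel_measurable_def by auto
  ultimately show "f_star p a \<alpha> \<in> Lp_on p {a..b}" by (simp add: Lp_on_def)
  have If: "(LINT x:{a..b}|lebesgue. f_star p a \<alpha> x powr p) = integral {a..b} (\<lambda>x. f_star p a \<alpha> x powr p)"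
    using fpi by (rule set_lebesgue_integral_eq_integral(2))
  have "0 < 1 + k\<^sup>2" by (simp add: add_pos_nonneg)
  then have R: "R > 0" by (simp add: R_def)
  have powx: "(x powr (-1/p)) powr p = 1 / x" if "x \<in> {a..b}" for x
  proof -
    have "(x powr (-1/p)) powr p = x powr (-1)"
      using p by (simp only: powr_powr) simp
    then show ?thesis
      using that ab by (simp add: powr_minus_divide)
  qed
  have fp: "f_star p a \<alpha> x powr p = R * (S (ln (b / x)) / x)" if x: "x \<in> {a..b}" for x
  proof -
    have "f_star p a \<alpha> x powr p = sqrt (1 + k\<^sup>2) powr p * (x powr (-1/p)) powr p * sin (\<alpha> * ln (b / x)) powr p"
      unfolding refl[OF x] using sin0[OF logs(2)[OF x]] by (simp add: powr_mult)
    also have "sqrt (1 + k\<^sup>2) powr p = R"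
    proof -
      have "sqrt (1 + k\<^sup>2) = (1 + k\<^sup>2) powr (1 / 2)"
        by (subst powr_half_sqrt) auto
      then have "sqrt (1 + k\<^sup>2) powr p = (1 + k\<^sup>2) powr (1 / 2 * p)"
        by (simp only: powr_powr)
      then show ?thesis by (simp add: R_def)
    qed
    finally show ?thesis unfolding powx[OF x] S_def by simp
  qed
  have ap: "hardy_avg a (f_star p a \<alpha>) x powr p = (p / (p - 1)) powr p * (S (ln (x / a)) / x)" if x: "x \<in> {a..b}" for x
  proof -
    have "hardy_avg a (f_star p a \<alpha>) x powr p = (p / (p - 1)) powr p * (x powr (-1/p)) powr p * sin (\<alpha> * ln (x / a)) powr p"
    proof -
      have "hardy_avg a (f_star p a \<alpha>) x = p / (p - 1) * x powr (-1/p) * sin (\<alpha> * ln (x / a))"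
        using x by (intro hardy_avg_f_star p ab) auto
      then show ?thesis by (simp only: powr_mult)
    qed
    then show ?thesis unfolding powx[OF x] S_def by simp
  qed
  have Ic: "integral {a..b} (\<lambda>x. f_star p a \<alpha> x powr p) = R * integral {a..b} (\<lambda>x. S (ln (x / a)) / x)"
  proof -
    have "integral {a..b} (\<lambda>x. f_star p a \<alpha> x powr p) = integral {a..b} (\<lambda>x. R * (S (ln (b / x)) / x))"
      by (intro integral_cong fp)
    then show ?thesis by (simp only: integral_mult_right integral_log_reflect[OF ab Sc])
  qed
  have SLc: "continuous_on {a..b} (\<lambda>x. (p / (p - 1)) powr p * (S (ln (x / a)) / x))"
    using ab logs by (intro continuous_intros continuous_on_compose2[OF Sc]) auto
  have "(LINT x:{a..b}|lebesgue. hardy_avg a (f_star p a \<alpha>) x powr p)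
      = (LINT x:{a..b}|lebesgue. (p / (p - 1)) powr p * (S (ln (x / a)) / x))"
    by (intro set_lebesgue_integral_cong) (auto simp: ap)
  also have "\<dots> = (p / (p - 1)) powr p * integral {a..b} (\<lambda>x. S (ln (x / a)) / x)"
    unfolding set_lebesgue_integral_eq_integral(2)[OF absolutely_integrable_continuous_real[OF SLc]]
    by (rule integral_mult_right)
  also have "\<dots> = (p / (p - 1)) powr p * (1 / R) * (R * integral {a..b} (\<lambda>x. S (ln (x / a)) / x))"
    using R by simp
  also have "1 / R = (1 + k\<^sup>2) powr (- p / 2)"
    using powr_minus_divide[of "1 + k\<^sup>2" "p / 2"] by (simp only: R_def minus_divide_left)
  finally show "(LINT x:{a..b}|lebesgue. hardy_avg a (f_star p a \<alpha>) x powr p)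
        = (p / (p - 1)) powr p * (1 + (\<alpha> * p / (p - 1))\<^sup>2) powr (- p / 2)
          * (LINT x:{a..b}|lebesgue. f_star p a \<alpha> x powr p)"
    unfolding If Ic k_def .
  have "integral {a..b} (\<lambda>x. f_star p a \<alpha> x powr p) \<noteq> 0"
  proof
    assume "integral {a..b} (\<lambda>x. f_star p a \<alpha> x powr p) = 0"
    then have "\<forall>x\<in>{a..b}. f_star p a \<alpha> x powr p = 0"
      using integral_eq_0_iff[OF fpc] ab by auto
    then have "f_star p a \<alpha> a powr p = 0" using ab by auto
    moreover have "0 < f_star p a \<alpha> a"
      using ab p r by (simp add: f_star_def)
    ultimately show False by simp
  qed
  moreover have "0 \<le> integral {a..b} (\<lambda>x. f_star p a \<alpha> x powr p)"
    by (intro integral_nonneg integrable_continuous_real fpc) auto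
  ultimately show "0 < (LINT x:{a..b}|lebesgue. f_star p a \<alpha> x powr p)"
    by (simp add: If)
qed

lemma one_plus_powr_minus_ge:
  fixes y r :: real
  assumes "0 \<le> y" "0 \<le> r"
  shows "1 - r * y \<le> (1 + y) powr (- r)"
proof -
  have "1 - r * y \<le> exp (- (r * y))"
    using exp_ge_add_one_self[of "- (r * y)"] by simp
  also have "\<dots> \<le> exp (- (r * ln (1 + y)))"
    using assms ln_add_one_self_le_self[of y] by (simp add: mult_left_mono)
  also have "\<dots> = (1 + y) powr (- r)"
    using assms by (simp add: powr_def)
  finally show ?thesis .
qed

text \<open>The exact quotient contains \<open>(1 + k\<^sup>2) powr (-p / 2) \<ge> 1 - p / 2 * k\<^sup>2\<close>, and \<open>\<alpha> < pi / ln (b / a)\<close>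
bounds \<open>k\<^sup>2\<close> by \<open>(p / (p - 1))\<^sup>2 * pi\<^sup>2 / (ln (b / a))\<^sup>2\<close>.\<close>

lemma f_star_almost_extremal:
  fixes p :: real
  assumes p: "p > 1" and ab: "0 < a" "a < b" and al: "is_alpha p a b \<alpha>"
  shows "(p / (p - 1)) powr p * (1 - p / 2 * (p / (p - 1))\<^sup>2 * pi\<^sup>2 / (ln (b / a))\<^sup>2)
      * (LINT x:{a..b}|lebesgue. f_star p a \<alpha> x powr p)
    \<le> (LINT x:{a..b}|lebesgue. hardy_avg a (f_star p a \<alpha>) x powr p)"
proof -
  let ?k = "\<alpha> * p / (p - 1)" and ?L = "ln (b / a)"
  have L: "?L > 0" using ab by simp
  have "0 < pi / (2 * ?L)" using L by simp
  then have r: "0 < \<alpha>" "\<alpha> < pi / ?L" using al by (auto simp: is_alpha_def intro: less_trans)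
  have "?k\<^sup>2 = \<alpha>\<^sup>2 * (p / (p - 1))\<^sup>2" by (simp add: power_mult_distrib power_divide)
  also have "\<dots> \<le> (pi / ?L)\<^sup>2 * (p / (p - 1))\<^sup>2"
    using r by (intro mult_right_mono power_mono) auto
  finally have "p / 2 * ?k\<^sup>2 \<le> p / 2 * ((pi / ?L)\<^sup>2 * (p / (p - 1))\<^sup>2)"
    using p by (intro mult_left_mono) auto
  then have "1 - p / 2 * (p / (p - 1))\<^sup>2 * pi\<^sup>2 / ?L\<^sup>2 \<le> 1 - p / 2 * ?k\<^sup>2"
    by (simp add: power_divide mult_ac)
  also have "\<dots> \<le> (1 + ?k\<^sup>2) powr (- p / 2)"
    using one_plus_powr_minus_ge[of "?k\<^sup>2" "p / 2"] p by simp
  finally show ?thesis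
    unfolding f_star_quotient[OF assms]
    using f_star_norm_pos[OF assms] by (intro mult_right_mono mult_left_mono) auto
qed

section \<open>Two-sided bounds for the best constant\<close>

theorem theorem1p3:
  fixes p :: real
  assumes "2 \<le> p"
  shows "\<exists>c1 c2 :: real. c1 > 0 \<and> c2 > 0 \<and>
    (\<forall>a b :: real. 0 < a \<and> a < b \<longrightarrow>
      ((p / (p - 1)) powr p * (1 - c1 / (ln (b / a))\<^sup>2) \<le> hardy_best p a b \<and>
       hardy_best p a b \<le> (p / (p - 1)) powr p * inverse (1 + c2 / (ln (b / a))\<^sup>2)) \<and>
      (\<exists>!\<alpha>. is_alpha p a b \<alpha>) \<and>
      (\<forall>\<alpha>. is_alpha p a b \<alpha> \<longrightarrow>
        (LINT x:{a..b}|lebesgue. (hardy_avg a (f_star p a \<alpha>) x) powr p)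
          \<ge> (p / (p - 1)) powr p * (1 - c1 / (ln (b / a))\<^sup>2) *
             (LINT x:{a..b}|lebesgue. (f_star p a \<alpha> x) powr p)))"
proof -
  define c1 where "c1 = p / 2 * (p / (p - 1))\<^sup>2 * pi\<^sup>2"
  define c2 where "c2 = (p / (p - 1))\<^sup>2 / 4"
  have p: "p > 1" using assms by simp
  have c: "c1 > 0" "c2 > 0" using p by (auto simp: c1_def c2_def)
  have extremal: "(p / (p - 1)) powr p * (1 - c1 / (ln (b / a))\<^sup>2)
        * (LINT x:{a..b}|lebesgue. f_star p a \<alpha> x powr p)
      \<le> (LINT x:{a..b}|lebesgue. hardy_avg a (f_star p a \<alpha>) x powr p)"
    if "0 < a" "a < b" "is_alpha p a b \<alpha>" for a b \<alpha>
    unfolding c1_def using p that by (rule f_star_almost_extremal)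
  have bounds: "(p / (p - 1)) powr p * (1 - c1 / (ln (b / a))\<^sup>2) \<le> hardy_best p a b"
    "hardy_best p a b \<le> (p / (p - 1)) powr p * inverse (1 + c2 / (ln (b / a))\<^sup>2)"
    if ab: "0 < a" "a < b" for a b
  proof -
    obtain \<alpha> where al: "is_alpha p a b \<alpha>" using ex1_is_alpha[OF p ab] by blast
    let ?f = "f_star p a \<alpha>"
    note facts = f_star_Lp[OF p ab al] f_star_nonneg[OF p ab al] f_star_norm_pos[OF p ab al]
    note least = hardy_bound_hardy_best[OF facts hardy_bound_log_improved[OF assms ab]]
      hardy_best_le[OF facts hardy_bound_log_improved[OF assms ab]]
    show "hardy_best p a b \<le> (p / (p - 1)) powr p * inverse (1 + c2 / (ln (b / a))\<^sup>2)"
      unfolding c2_def by (intro least(2) hardy_bound_log_improved assms ab)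
    have "(p / (p - 1)) powr p * (1 - c1 / (ln (b / a))\<^sup>2) * (LINT x:{a..b}|lebesgue. ?f x powr p)
        \<le> (LINT x:{a..b}|lebesgue. hardy_avg a ?f x powr p)"
      using ab al by (rule extremal)
    also have "\<dots> \<le> hardy_best p a b * (LINT x:{a..b}|lebesgue. ?f x powr p)"
      using least(1) facts(1,2) by (simp add: hardy_bound_def)
    finally show "(p / (p - 1)) powr p * (1 - c1 / (ln (b / a))\<^sup>2) \<le> hardy_best p a b"
      using facts(3) by simp
  qed
  show ?thesis
  proof (rule exI[of _ c1], rule exI[of _ c2], intro conjI allI impI)
    fix a b :: real assume "0 < a \<and> a < b"
    then have ab: "0 < a" "a < b" by auto
    show "(p / (p - 1)) powr p * (1 - c1 / (ln (b / a))\<^sup>2) \<le> hardy_best p a b"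
      "hardy_best p a b \<le> (p / (p - 1)) powr p * inverse (1 + c2 / (ln (b / a))\<^sup>2)"
      using ab by (fact bounds)+
    show "\<exists>!\<alpha>. is_alpha p a b \<alpha>"
      using p ab by (rule ex1_is_alpha)
    fix \<alpha> assume "is_alpha p a b \<alpha>"
    with ab show "(p / (p - 1)) powr p * (1 - c1 / (ln (b / a))\<^sup>2)
        * (LINT x:{a..b}|lebesgue. f_star p a \<alpha> x powr p)
      \<le> (LINT x:{a..b}|lebesgue. hardy_avg a (f_star p a \<alpha>) x powr p)"
      by (rule extremal)
  qed (fact c)+
qed

end
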